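(* Let $\leadsto'$ be the context-reduction relation defined by the same rules as $\leadsto$ except that its weakening rule omits the side condition $x\notin|\Omega_L\Omega_R|$ (so the added hypothesis may already occur in the context). Then for all $\Gamma$, $r$, $\Omega$ (with $\Omega\geq r$ and all hypotheses of $\Omega$ in $\Gamma$), $\{\Omega'\mid \Omega\leadsto'^{\Gamma}_{r}\Omega'\} = \{\Omega'\mid\Omega\leadsto^{\Gamma}_{r}\Omega'\}$.
   Context: Fix a preorder $(\mathcal{M},\geq)$ of modes and, for each mode $m$, a set $\sigma(m)\subseteq\{\mathsf{W},\mathsf{C}^\leftarrow,\mathsf{C}^\rightarrow,\mathsf{M}^\leftarrow,\mathsf{M}^\rightarrow\}$ (weakening, left/right contraction, left/right mobility), monotone: $k\geq m$ implies $\sigma(k)\supseteq\sigma(m)$, and satisfying the closure properties: if $\mathsf{W},\mathsf{C}^\leftarrow\in\sigma(m)$ then $\mathsf{M}^\leftarrow\in\sigma(m)$; if $\mathsf{W},\mathsf{C}^\rightarrow\in\sigma(m)$ then $\mathsf{M}^\rightarrow\in\sigma(m)$. Propositions $A_m$ are indexed by modes. An ordered context $\Omega$ is a finite sequence of labeled hypotheses $x{:}A_m$ (repetitions allowed, each variable always labeling the same proposition); $|\Omega|$ is its set of variables; $\Omega\geq r$ means every $y{:}B_k$ in $\Omega$ has $k\geq r$; $\Omega$ is normal ($\Omega\ \mathsf{nf}$) if no variable occurs twice. $\Gamma$ is an unordered finite set of labeled hypotheses. The relation $\Omega\leadsto^{\Gamma}_{r}\Omega'$ (presupposing $\Omega\subseteq\Gamma$,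 $\Omega\geq r$) is generated by the rules (premise $\Rightarrow$ conclusion): (W) $\Omega_L(x{:}A_m)\Omega_R\leadsto\Omega'$, $\mathsf{W}\in\sigma(m)$, $m\geq r$, $x{:}A_m\in\Gamma$, $x\notin|\Omega_L\Omega_R|\Rightarrow\Omega_L\Omega_R\leadsto\Omega'$; ($\mathsf{C}^\leftarrow$) $\Omega_L(x{:}A_m)\Omega_M\Omega_R\leadsto\Omega'$, $\mathsf{C}^\leftarrow\in\sigma(m)\Rightarrow\Omega_L(x{:}A_m)\Omega_M(x{:}A_m)\Omega_R\leadsto\Omega'$; ($\mathsf{C}^\rightarrow$) $\Omega_L\Omega_M(x{:}A_m)\Omega_R\leadsto\Omega'$, $\mathsf{C}^\rightarrow\in\sigma(m)\Rightarrow\Omega_L(x{:}A_m)\Omega_M(x{:}A_m)\Omega_R\leadsto\Omega'$; ($\mathsf{M}^\leftarrow$) $\Omega_L(x{:}A_m)\Omega_M\Omega_R\leadsto\Omega'$, $\mathsf{M}^\leftarrow\in\sigma(m)\Rightarrow\Omega_L\Omega_M(x{:}A_m)\Omega_R\leadsto\Omega'$; ($\mathsf{M}^\rightarrow$) $\Omega_L\Omega_M(x{:}A_m)\Omega_R\leadsto\Omega'$, $\mathsf{M}^\rightarrow\in\sigma(m)\Rightarrow\Omega_L(x{:}A_m)\Omega_M\Omega_R\leadsto\Omega'$; (id) $\Omega\ \mathsf{nf}\Rightarrow\Omega\leadsto\Omega$. (All arrows carry the same $\Gamma$ and $r$.) *)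

theory Defs
  imports Main
begin

datatype structural =
    Weakening
  | Contraction_Left
  | Contraction_Right
  | Mobility_Left
  | Mobility_Right

definition mode_signature :: "('m::preorder \<Rightarrow> structural set) \<Rightarrow> bool" where
  "mode_signature \<sigma> \<longleftrightarrow>
     (\<forall>k m. k \<ge> m \<longrightarrow> \<sigma> k \<supseteq> \<sigma> m) \<and>
     (\<forall>m. Weakening \<in> \<sigma> m \<and> Contraction_Left \<in> \<sigma> m \<longrightarrow> Mobility_Left \<in> \<sigma> m) \<and>
     (\<forall>m. Weakening \<in> \<sigma> m \<and> Contraction_Right \<in> \<sigma> m \<longrightarrow> Mobility_Right \<in> \<sigma> m)"

text \<open>The mode-indexed family of propositions is given as a type \<open>'p\<close> of all propositions
  together with an arbitrary map \<open>md :: 'p \<Rightarrow> 'm\<close>: the propositions at mode \<open>m\<close> are the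
  fibre of \<open>md\<close> over \<open>m\<close>. A hypothesis is a pair of a variable and a proposition.\<close>

type_synonym ('v, 'p) hyp = "'v \<times> 'p"

text \<open>Lists with repetitions in which each variable always labels the same proposition.\<close>

definition ordered_context :: "('v, 'p) hyp list \<Rightarrow> bool" where
  "ordered_context \<Omega> \<longleftrightarrow> single_valued (set \<Omega>)"

definition ctx_vars :: "('v, 'p) hyp list \<Rightarrow> 'v set" where
  "ctx_vars \<Omega> = fst ` set \<Omega>"

definition ctx_ge :: "('p \<Rightarrow> 'm::preorder) \<Rightarrow> ('v, 'p) hyp list \<Rightarrow> 'm \<Rightarrow> bool" where
  "ctx_ge md \<Omega> r \<longleftrightarrow> (\<forall>(y, B) \<in> set \<Omega>. md B \<ge> r)"

definition normal :: "('v, 'p) hyp list \<Rightarrow> bool" where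
  "normal \<Omega> \<longleftrightarrow> distinct (map fst \<Omega>)"

text \<open>The presuppositions of the judgement (\<open>ordered_context \<Omega>\<close>, \<open>set \<Omega> \<subseteq> \<Gamma>\<close> and
  \<open>ctx_ge md \<Omega> r\<close>) are not premises of the rules; they have to be assumed of the context
  being reduced. The inductive rules read from premise to conclusion, so reduction of
  \<open>\<Omega>\<close> proceeds from conclusion to premise.\<close>

inductive reduces ::
  "('m::preorder \<Rightarrow> structural set) \<Rightarrow> ('p \<Rightarrow> 'm) \<Rightarrow> ('v, 'p) hyp set \<Rightarrow> 'm
    \<Rightarrow> ('v, 'p) hyp list \<Rightarrow> ('v, 'p) hyp list \<Rightarrow> bool"
  for \<sigma> :: "'m::preorder \<Rightarrow> structural set" and md :: "'p \<Rightarrow> 'm"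
    and \<Gamma> :: "('v, 'p) hyp set" and r :: 'm
where
  weakening:
    "\<lbrakk>reduces \<sigma> md \<Gamma> r (L @ [(x, A)] @ R) \<Omega>'; Weakening \<in> \<sigma> (md A); md A \<ge> r;
      (x, A) \<in> \<Gamma>; x \<notin> ctx_vars (L @ R)\<rbrakk>
     \<Longrightarrow> reduces \<sigma> md \<Gamma> r (L @ R) \<Omega>'"
| contraction_left:
    "\<lbrakk>reduces \<sigma> md \<Gamma> r (L @ [(x, A)] @ M @ R) \<Omega>'; Contraction_Left \<in> \<sigma> (md A)\<rbrakk>
     \<Longrightarrow> reduces \<sigma> md \<Gamma> r (L @ [(x, A)] @ M @ [(x, A)] @ R) \<Omega>'"
| contraction_right:
    "\<lbrakk>reduces \<sigma> md \<Gamma> r (L @ M @ [(x, A)] @ R) \<Omega>'; Contraction_Right \<in> \<sigma> (md A)\<rbrakk>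
     \<Longrightarrow> reduces \<sigma> md \<Gamma> r (L @ [(x, A)] @ M @ [(x, A)] @ R) \<Omega>'"
| mobility_left:
    "\<lbrakk>reduces \<sigma> md \<Gamma> r (L @ [(x, A)] @ M @ R) \<Omega>'; Mobility_Left \<in> \<sigma> (md A)\<rbrakk>
     \<Longrightarrow> reduces \<sigma> md \<Gamma> r (L @ M @ [(x, A)] @ R) \<Omega>'"
| mobility_right:
    "\<lbrakk>reduces \<sigma> md \<Gamma> r (L @ M @ [(x, A)] @ R) \<Omega>'; Mobility_Right \<in> \<sigma> (md A)\<rbrakk>
     \<Longrightarrow> reduces \<sigma> md \<Gamma> r (L @ [(x, A)] @ M @ R) \<Omega>'"
| id: "normal \<Omega> \<Longrightarrow> reduces \<sigma> md \<Gamma> r \<Omega> \<Omega>"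

text \<open>The same rules, but weakening has no freshness condition.\<close>

inductive reduces' ::
  "('m::preorder \<Rightarrow> structural set) \<Rightarrow> ('p \<Rightarrow> 'm) \<Rightarrow> ('v, 'p) hyp set \<Rightarrow> 'm
    \<Rightarrow> ('v, 'p) hyp list \<Rightarrow> ('v, 'p) hyp list \<Rightarrow> bool"
  for \<sigma> :: "'m::preorder \<Rightarrow> structural set" and md :: "'p \<Rightarrow> 'm"
    and \<Gamma> :: "('v, 'p) hyp set" and r :: 'm
where
  weakening:
    "\<lbrakk>reduces' \<sigma> md \<Gamma> r (L @ [(x, A)] @ R) \<Omega>'; Weakening \<in> \<sigma> (md A); md A \<ge> r;
      (x, A) \<in> \<Gamma>\<rbrakk>
     \<Longrightarrow> reduces' \<sigma> md \<Gamma> r (L @ R) \<Omega>'"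
| contraction_left:
    "\<lbrakk>reduces' \<sigma> md \<Gamma> r (L @ [(x, A)] @ M @ R) \<Omega>'; Contraction_Left \<in> \<sigma> (md A)\<rbrakk>
     \<Longrightarrow> reduces' \<sigma> md \<Gamma> r (L @ [(x, A)] @ M @ [(x, A)] @ R) \<Omega>'"
| contraction_right:
    "\<lbrakk>reduces' \<sigma> md \<Gamma> r (L @ M @ [(x, A)] @ R) \<Omega>'; Contraction_Right \<in> \<sigma> (md A)\<rbrakk>
     \<Longrightarrow> reduces' \<sigma> md \<Gamma> r (L @ [(x, A)] @ M @ [(x, A)] @ R) \<Omega>'"
| mobility_left:
    "\<lbrakk>reduces' \<sigma> md \<Gamma> r (L @ [(x, A)] @ M @ R) \<Omega>'; Mobility_Left \<in> \<sigma> (md A)\<rbrakk>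
     \<Longrightarrow> reduces' \<sigma> md \<Gamma> r (L @ M @ [(x, A)] @ R) \<Omega>'"
| mobility_right:
    "\<lbrakk>reduces' \<sigma> md \<Gamma> r (L @ M @ [(x, A)] @ R) \<Omega>'; Mobility_Right \<in> \<sigma> (md A)\<rbrakk>
     \<Longrightarrow> reduces' \<sigma> md \<Gamma> r (L @ [(x, A)] @ M @ R) \<Omega>'"
| id: "normal \<Omega> \<Longrightarrow> reduces' \<sigma> md \<Gamma> r \<Omega> \<Omega>"

end

(* Every context reachable in the liberal system is simulated by a thinned context, from which
   some copies of weakenable hypotheses are missing, but never all copies of one hypothesis.
   Weakening by a hypothesis that already occurs thus becomes a missing copy and needs no step.
   A contraction whose surviving copy is the missing one becomes a move of the other copy, which
   the closure conditions on signatures permit. At a normal context nothing can be missing. *)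

theory Submission
  imports Defs
begin

text \<open>Nothing here prevents all copies of an element from being dropped. Where that matters, a
  separate condition on the sets of elements excludes it.\<close>

inductive thinning :: "('a \<Rightarrow> bool) \<Rightarrow> 'a list \<Rightarrow> 'a list \<Rightarrow> bool"
  for P :: "'a \<Rightarrow> bool"
where
  Nil: "thinning P [] []"
| keep: "thinning P xs ys \<Longrightarrow> thinning P (x # xs) (x # ys)"
| drop: "thinning P xs ys \<Longrightarrow> P x \<Longrightarrow> thinning P (x # xs) ys"

lemma thinning_refl: "thinning P xs xs"
  by (induction xs) (auto intro: thinning.intros)

lemma thinning_Nil_iff: "thinning P [] ys \<longleftrightarrow> ys = []"
  by (auto intro: thinning.intros elim: thinning.cases)

lemma thinning_Cons_iff:
  "thinning P (x # xs) ys \<longleftrightarrow> (\<exists>zs. ys = x # zs \<and> thinning P xs zs) \<or> P x \<and> thinning P xs ys"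
  by (subst thinning.simps) auto

lemma thinning_append:
  "thinning P xs ys \<Longrightarrow> thinning P xs' ys' \<Longrightarrow> thinning P (xs @ xs') (ys @ ys')"
  by (induction rule: thinning.induct) (auto intro: thinning.intros)

text \<open>The rules cut contexts by \<open>@\<close>, so a thinning of a conclusion has to be cut
  at the same places before its pieces can be rearranged to match the premise.\<close>

lemma thinning_appendE:
  assumes "thinning P (xs @ xs') zs"
  obtains ys ys' where "zs = ys @ ys'" "thinning P xs ys" "thinning P xs' ys'"
  using assms
proof (induction xs arbitrary: zs thesis)
  case Nil
  then show ?case by (simp add: thinning_Nil_iff)
next
  case (Cons x xs)
  from Cons.prems(2) consider
      (keep) us where "zs = x # us" "thinning P (xs @ xs') us"
    | (drop) "P x" "thinning P (xs @ xs') zs"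
    by (auto simp: thinning_Cons_iff)
  then show ?case
  proof cases
    case keep
    obtain ys ys' where "us = ys @ ys'" "thinning P xs ys" "thinning P xs' ys'"
      using Cons.IH[OF _ keep(2)] by blast
    then show thesis
      using Cons.prems(1)[of "x # ys" ys'] keep(1) by (simp add: thinning.keep)
  next
    case drop
    obtain ys ys' where "zs = ys @ ys'" "thinning P xs ys" "thinning P xs' ys'"
      using Cons.IH[OF _ drop(2)] by blast
    then show thesis
      using Cons.prems(1)[of ys ys'] drop(1) by (simp add: thinning.drop)
  qed
qed

lemma thinning_singleton_iff: "thinning P [x] ys \<longleftrightarrow> ys = [x] \<or> P x \<and> ys = []"
  by (auto simp: thinning_Cons_iff thinning_Nil_iff)

lemma thinning_set: "thinning P xs ys \<Longrightarrow> set ys \<subseteq> set xs"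
  by (induction rule: thinning.induct) auto

text \<open>A dropped element would still have to occur in \<open>ys\<close>, hence in the rest of
  \<open>xs\<close>, and so would be a second copy.\<close>

lemma thinning_distinct_eq:
  "thinning P xs ys \<Longrightarrow> distinct xs \<Longrightarrow> set xs \<subseteq> set ys \<Longrightarrow> ys = xs"
proof (induction rule: thinning.induct)
  case (keep xs ys x)
  then have "set xs \<subseteq> set ys" by auto
  with keep show ?case by simp
next
  case (drop xs ys x)
  then have "x \<in> set xs"
    using thinning_set[OF drop.hyps(1)] by (metis list.set_intros(1) subsetD)
  with drop.prems(1) show ?case by simp
qed simp

lemma reduces'_if_reduces:
  "reduces \<sigma> md \<Gamma> r \<Omega> \<Omega>' \<Longrightarrow> reduces' \<sigma> md \<Gamma> r \<Omega> \<Omega>'"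
  by (induction rule: reduces.induct) (erule reduces'.intros; assumption)+

text \<open>From conclusion to premise, weakening only adds, mobility only permutes, and a
  contracted copy leaves its twin behind.\<close>

lemma reduces'_set_subset: "reduces' \<sigma> md \<Gamma> r \<Omega> \<Omega>' \<Longrightarrow> set \<Omega> \<subseteq> set \<Omega>'"
  by (induction rule: reduces'.induct) auto

lemma reduces'_normal: "reduces' \<sigma> md \<Gamma> r \<Omega> \<Omega>' \<Longrightarrow> normal \<Omega>'"
  by (induction rule: reduces'.induct) auto

lemma normal_imp_ordered_context: "normal \<Omega> \<Longrightarrow> ordered_context \<Omega>"
  by (auto simp: normal_def ordered_context_def single_valued_def dest: eq_key_imp_eq_value)

(* The rules do not force \<Gamma> to be single-valued, so weakening may add a variable that already
   labels another proposition; hypotheses never vanish altogether, so no normal context can be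
   reached afterwards. *)
lemma reduces'_ordered_context: "reduces' \<sigma> md \<Gamma> r \<Omega> \<Omega>' \<Longrightarrow> ordered_context \<Omega>"
  unfolding ordered_context_def
  by (rule single_valued_subset[OF reduces'_set_subset
        normal_imp_ordered_context[OF reduces'_normal, unfolded ordered_context_def]])

abbreviation weakenable ::
  "('m \<Rightarrow> structural set) \<Rightarrow> ('p \<Rightarrow> 'm) \<Rightarrow> ('v, 'p) hyp \<Rightarrow> bool" where
  "weakenable \<sigma> md h \<equiv> Weakening \<in> \<sigma> (md (snd h))"

text \<open>The set equation is the invariant that some copy of each hypothesis survives.
  \<open>\<Psi>\<close> is arbitrary in the induction because the missing copies change along the
  derivation.\<close>

lemma reduces_thinning:
  assumes sig: "mode_signature \<sigma>"
  shows "reduces' \<sigma> md \<Gamma> r \<Omega> \<Omega>' \<Longrightarrow> thinning (weakenable \<sigma> md) \<Omega> \<Psi> \<Longrightarrow> set \<Psi> = set \<Omega> \<Longrightarrow>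
    reduces \<sigma> md \<Gamma> r \<Psi> \<Omega>'"
proof (induction arbitrary: \<Psi> rule: reduces'.induct)
  case (weakening L x A R \<Omega>')
  let ?h = "(x, A)"
  obtain L2 R2 where \<Psi>: "\<Psi> = L2 @ R2"
    and L2: "thinning (weakenable \<sigma> md) L L2" and R2: "thinning (weakenable \<sigma> md) R R2"
    using weakening.prems(1) by (rule thinning_appendE)
  \<comment> \<open>The added hypothesis is weakenable, so its copy may be recorded as present or as
    missing.\<close>
  have extend: "thinning (weakenable \<sigma> md) (L @ [?h] @ R) (L2 @ H @ R2)" if "H = [] \<or> H = [?h]" for H
    using that weakening.hyps(2) by (intro thinning_append L2 R2) (auto simp: thinning_singleton_iff)
  show ?case
  proof (cases "?h \<in> set (L @ R)")
    case True
    \<comment> \<open>Record the new copy as missing: \<open>\<Psi>\<close> itself thins the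
      extended context, and another copy preserves the set equation.\<close>
    then show ?thesis
      using weakening.IH[OF extend[of "[]"]] weakening.prems(2) \<Psi> by auto
  next
    case False
    \<comment> \<open>Absence of the pair \<open>(x, A)\<close> is weaker than freshness of
      \<open>x\<close>. Single-valuedness excludes that \<open>x\<close> labels another
      proposition.\<close>
    have "ordered_context (L @ [?h] @ R)"
      using weakening.hyps(1) by (rule reduces'_ordered_context)
    then have "x \<notin> ctx_vars (L @ R)"
      using False unfolding ordered_context_def single_valued_def ctx_vars_def by fastforce
    then have fresh: "x \<notin> ctx_vars (L2 @ R2)"
      using weakening.prems(2) \<Psi> by (simp add: ctx_vars_def)
    have "reduces \<sigma> md \<Gamma> r (L2 @ [?h] @ R2) \<Omega>'"
      using weakening.IH[OF extend[of "[?h]"]] weakening.prems(2) \<Psi> by auto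
    then show ?thesis
      unfolding \<Psi> using weakening.hyps(2-4) fresh by (rule reduces.weakening)
  qed
next
  case (contraction_left L x A M R \<Omega>')
  let ?h = "(x, A)"
  obtain L2 H M2 H' R2 where \<Psi>: "\<Psi> = L2 @ H @ M2 @ H' @ R2"
    and thin: "thinning (weakenable \<sigma> md) L L2" "thinning (weakenable \<sigma> md) [?h] H"
      "thinning (weakenable \<sigma> md) M M2" "thinning (weakenable \<sigma> md) [?h] H'"
      "thinning (weakenable \<sigma> md) R R2"
    using contraction_left.prems(1) by (elim thinning_appendE) (simp only: append_assoc)
  \<comment> \<open>\<open>G\<close> is what remains of the surviving copy. It may be taken from
    either \<open>H\<close> or \<open>H'\<close>, whichever is present.\<close>
  have IH: "reduces \<sigma> md \<Gamma> r (L2 @ G @ M2 @ R2) \<Omega>'"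
    if "thinning (weakenable \<sigma> md) [?h] G" "set (L2 @ G @ M2 @ R2) = set \<Psi>" for G
    using that contraction_left.prems(2)
    by (intro contraction_left.IH thinning_append thin) auto
  consider "H = [?h]" "H' = [?h]" | "H' = []" | "H = []" "H' = [?h]" "Weakening \<in> \<sigma> (md A)"
    using thin(2,4) by (auto simp: thinning_singleton_iff)
  then show ?case
  proof cases
    case 1
    then show ?thesis
      using IH[of H] thin(2) contraction_left.hyps(2) \<Psi>
      using reduces.contraction_left[of \<sigma> md \<Gamma> r L2 x A M2 R2 \<Omega>'] by auto
  next
    case 2
    then show ?thesis using IH[of H] thin(2) \<Psi> by simp
  next
    case 3
    \<comment> \<open>Only the right copy is present, but the premise has it on the left. It was
      allowed to drop the left copy only because of weakening, which together with left contraction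
      gives left mobility.\<close>
    then have "Mobility_Left \<in> \<sigma> (md A)"
      using sig contraction_left.hyps(2) by (auto simp: mode_signature_def)
    then show ?thesis
      using 3 IH[of "[?h]"] thin(4) \<Psi>
      using reduces.mobility_left[of \<sigma> md \<Gamma> r L2 x A M2 R2 \<Omega>'] by auto
  qed
next
  case (contraction_right L M x A R \<Omega>')
  let ?h = "(x, A)"
  obtain L2 H M2 H' R2 where \<Psi>: "\<Psi> = L2 @ H @ M2 @ H' @ R2"
    and thin: "thinning (weakenable \<sigma> md) L L2" "thinning (weakenable \<sigma> md) [?h] H"
      "thinning (weakenable \<sigma> md) M M2" "thinning (weakenable \<sigma> md) [?h] H'"
      "thinning (weakenable \<sigma> md) R R2"
    using contraction_right.prems(1) by (elim thinning_appendE) (simp only: append_assoc)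
  have IH: "reduces \<sigma> md \<Gamma> r (L2 @ M2 @ G @ R2) \<Omega>'"
    if "thinning (weakenable \<sigma> md) [?h] G" "set (L2 @ M2 @ G @ R2) = set \<Psi>" for G
    using that contraction_right.prems(2)
    by (intro contraction_right.IH thinning_append thin) auto
  consider "H = [?h]" "H' = [?h]" | "H = []" | "H = [?h]" "H' = []" "Weakening \<in> \<sigma> (md A)"
    using thin(2,4) by (auto simp: thinning_singleton_iff)
  then show ?case
  proof cases
    case 1
    then show ?thesis
      using IH[of H'] thin(4) contraction_right.hyps(2) \<Psi>
      using reduces.contraction_right[of \<sigma> md \<Gamma> r L2 M2 x A R2 \<Omega>'] by auto
  next
    case 2
    then show ?thesis using IH[of H'] thin(4) \<Psi> by simp
  next
    case 3
    \<comment> \<open>Mirror image: the only present copy has to move to the right.\<close>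
    then have "Mobility_Right \<in> \<sigma> (md A)"
      using sig contraction_right.hyps(2) by (auto simp: mode_signature_def)
    then show ?thesis
      using 3 IH[of "[?h]"] thin(2) \<Psi>
      using reduces.mobility_right[of \<sigma> md \<Gamma> r L2 M2 x A R2 \<Omega>'] by auto
  qed
next
  case (mobility_left L x A M R \<Omega>')
  let ?h = "(x, A)"
  obtain L2 M2 H R2 where \<Psi>: "\<Psi> = L2 @ M2 @ H @ R2"
    and thin: "thinning (weakenable \<sigma> md) L L2" "thinning (weakenable \<sigma> md) M M2"
      "thinning (weakenable \<sigma> md) [?h] H" "thinning (weakenable \<sigma> md) R R2"
    using mobility_left.prems(1) by (elim thinning_appendE) (simp only: append_assoc)
  have "reduces \<sigma> md \<Gamma> r (L2 @ H @ M2 @ R2) \<Omega>'"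
    using mobility_left.prems(2) \<Psi> by (intro mobility_left.IH thinning_append thin) auto
  moreover have "H = [] \<or> H = [?h]"
    using thin(3) by (auto simp: thinning_singleton_iff)
  ultimately show ?case
    using \<Psi> mobility_left.hyps(2) reduces.mobility_left[of \<sigma> md \<Gamma> r L2 x A M2 R2 \<Omega>'] by auto
next
  case (mobility_right L M x A R \<Omega>')
  let ?h = "(x, A)"
  obtain L2 H M2 R2 where \<Psi>: "\<Psi> = L2 @ H @ M2 @ R2"
    and thin: "thinning (weakenable \<sigma> md) L L2" "thinning (weakenable \<sigma> md) [?h] H"
      "thinning (weakenable \<sigma> md) M M2" "thinning (weakenable \<sigma> md) R R2"
    using mobility_right.prems(1) by (elim thinning_appendE) (simp only: append_assoc)
  have "reduces \<sigma> md \<Gamma> r (L2 @ M2 @ H @ R2) \<Omega>'"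
    using mobility_right.prems(2) \<Psi> by (intro mobility_right.IH thinning_append thin) auto
  moreover have "H = [] \<or> H = [?h]"
    using thin(2) by (auto simp: thinning_singleton_iff)
  ultimately show ?case
    using \<Psi> mobility_right.hyps(2) reduces.mobility_right[of \<sigma> md \<Gamma> r L2 M2 x A R2 \<Omega>'] by auto
next
  case (id \<Omega>)
  have "distinct \<Omega>"
    using id.hyps by (simp add: normal_def distinct_map)
  then have "\<Psi> = \<Omega>"
    using thinning_distinct_eq id.prems by blast
  then show ?case using id.hyps by (simp add: reduces.id)
qed

theorem theorem6:
  fixes \<sigma> :: "'m::preorder \<Rightarrow> structural set"
    and md :: "'p \<Rightarrow> 'm"
    and \<Gamma> :: "('v, 'p) hyp set"
    and r :: 'm
    and \<Omega> :: "('v, 'p) hyp list"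
  assumes "mode_signature \<sigma>"
    and "finite \<Gamma>"
    and "ordered_context \<Omega>"
    and "set \<Omega> \<subseteq> \<Gamma>"
    and "ctx_ge md \<Omega> r"
  shows "{\<Omega>'. reduces' \<sigma> md \<Gamma> r \<Omega> \<Omega>'} = {\<Omega>'. reduces \<sigma> md \<Gamma> r \<Omega> \<Omega>'}"
  \<comment> \<open>The simulation starts with no copy missing.\<close>
  by (intro Collect_eqI iffI reduces'_if_reduces)
    (rule reduces_thinning[OF assms(1) _ thinning_refl refl])

end
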